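(* Let $H=(V,E)$ be a hypergraph with $n=|V|$, let $e\in E$, and let $1\leq i<j\leq n$. Define $$b_e^{i,j}=\sum_{F\in\mathcal{B}_e^{i,j}}(-1)^{|F|},\qquad \mathcal{B}_e^{i,j}=\{F\subseteq E\mid e\in F,\ k(F)=i,\ k(F\setminus\{e\})=j\}.$$ Then $$b_e^{i,j}=-\sum_{V_1\sqcup\dots\sqcup V_j=V}\ \prod_{k=1}^{j}a_1(H[V_k]),$$ where the sum is over all (unordered) decompositions of $V$ into $j$ non-empty disjoint subsets $V_1,\dots,V_j$ such that $e$ intersects exactly $j-i+1$ of them.
   Context: A hypergraph is a pair $H=(V,E)$ where $V$ is a finite non-empty set (vertices) and $E$ is a set of subsets of $V$ (edges), each of cardinality at least $2$. Two distinct vertices are neighbours if some edge contains both; connectedness of vertices is the equivalence relation generated by being neighbours, and the connected components are given by its equivalence classes. For $F\subseteq E$, $k(F)$ denotes the number of connected components of the spanning subgraph $(V,F)$ (isolated vertices count as components). For non-empty $V'\subseteq V$, $H[V']$ is the hypergraph with vertex set $V'$ and edge set $\{f\in E\mid f\subseteq V'\}$. For any hypergraph $H'=(V',E')$, $a_1(H')=\sum_{F\subseteq E',\,k(F)=1}(-1)^{|F|}$, where $k(F)$ is the number of connected components of $(V',F)$; this is the coefficient of $\lambda$ in the chromatic polynomial of $H'$. *)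

theory Defs
  imports Main "HOL-Library.Disjoint_Sets"
begin

definition hypergraph :: "'a set \<Rightarrow> 'a set set \<Rightarrow> bool" where
  "hypergraph V E \<longleftrightarrow> finite V \<and> V \<noteq> {} \<and> (\<forall>f\<in>E. f \<subseteq> V \<and> 2 \<le> card f)"

definition neighbours :: "'a set \<Rightarrow> 'a set set \<Rightarrow> 'a rel" where
  "neighbours V F = {(u, v). u \<in> V \<and> v \<in> V \<and> u \<noteq> v \<and> (\<exists>f\<in>F. u \<in> f \<and> v \<in> f)}"

text \<open>The neighbour relation is symmetric, so its reflexive transitive closure, restricted to
  \<open>V\<close>, is the equivalence relation on \<open>V\<close> generated by it; see the two lemmas below.\<close>

definition connected_rel :: "'a set \<Rightarrow> 'a set set \<Rightarrow> 'a rel" where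
  "connected_rel V F = Restr ((neighbours V F)\<^sup>*) V"

lemma equiv_connected_rel: "equiv V (connected_rel V F)"
proof (rule equivI)
  show "connected_rel V F \<subseteq> V \<times> V"
    by (auto simp: connected_rel_def)
  show "refl_on V (connected_rel V F)"
    by (auto simp: refl_on_def connected_rel_def)
  have "sym (neighbours V F)"
    by (auto simp: sym_def neighbours_def)
  then have "sym ((neighbours V F)\<^sup>*)"
    by (rule sym_rtrancl)
  then show "sym (connected_rel V F)"
    by (auto simp: sym_def connected_rel_def)
  show "trans (connected_rel V F)"
    by (auto simp: connected_rel_def intro!: transI intro: rtrancl_trans)
qed

lemma connected_rel_generated:
  "connected_rel V F = \<Inter>{r. equiv V r \<and> neighbours V F \<subseteq> r}"
proof
  show "connected_rel V F \<subseteq> \<Inter>{r. equiv V r \<and> neighbours V F \<subseteq> r}"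
  proof clarify
    fix u v r
    assume uv: "(u, v) \<in> connected_rel V F" and r: "equiv V r" "neighbours V F \<subseteq> r"
    from uv have "(u, v) \<in> (neighbours V F)\<^sup>*" "u \<in> V"
      by (auto simp: connected_rel_def)
    then show "(u, v) \<in> r"
    proof (induction rule: rtrancl_induct)
      case base
      then show ?case using r(1) by (auto elim!: equivE dest: refl_onD)
    next
      case (step y z)
      then show ?case using r by (meson equivE subsetD transD)
    qed
  qed
  have "neighbours V F \<subseteq> connected_rel V F"
    by (auto simp: connected_rel_def neighbours_def)
  then show "\<Inter>{r. equiv V r \<and> neighbours V F \<subseteq> r} \<subseteq> connected_rel V F"
    using equiv_connected_rel by blast
qed

definition num_components :: "'a set \<Rightarrow> 'a set set \<Rightarrow> nat" where
  "num_components V F = card (V // connected_rel V F)"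

definition induced_edges :: "'a set set \<Rightarrow> 'a set \<Rightarrow> 'a set set" where
  "induced_edges E W = {f \<in> E. f \<subseteq> W}"

definition a1 :: "'a set \<Rightarrow> 'a set set \<Rightarrow> int" where
  "a1 V E = (\<Sum>F | F \<subseteq> E \<and> num_components V F = 1. (-1) ^ card F)"

definition b_family :: "'a set \<Rightarrow> 'a set set \<Rightarrow> 'a set \<Rightarrow> nat \<Rightarrow> nat \<Rightarrow> 'a set set set" where
  "b_family V E e i j =
     {F. F \<subseteq> E \<and> e \<in> F \<and> num_components V F = i \<and> num_components V (F - {e}) = j}"

definition b_coeff :: "'a set \<Rightarrow> 'a set set \<Rightarrow> 'a set \<Rightarrow> nat \<Rightarrow> nat \<Rightarrow> int" where
  "b_coeff V E e i j = (\<Sum>F\<in>b_family V E e i j. (-1) ^ card F)"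

text \<open>Unordered decompositions of \<open>V\<close> into \<open>j\<close> non-empty disjoint subsets, exactly \<open>m\<close> of which
  meet \<open>e\<close> (\<open>partition_on\<close> excludes the empty part).\<close>

definition decompositions :: "'a set \<Rightarrow> 'a set \<Rightarrow> nat \<Rightarrow> nat \<Rightarrow> 'a set set set" where
  "decompositions V e j m =
     {P. partition_on V P \<and> card P = j \<and> card {W \<in> P. W \<inter> e \<noteq> {}} = m}"

end

theory Submission
  imports Defs
begin

text \<open>If \<open>m\<close> components of \<open>(V, G)\<close> meet \<open>e\<close>, then adding \<open>e\<close> merges exactly these, so
  \<open>k(G \<union> {e}) = k(G) - m + 1\<close>. Hence \<open>b_coeff\<close> is, up to sign, the sum of \<open>(-1)^|G|\<close> over all
  \<open>G \<subseteq> E\<close> with \<open>j\<close> components, \<open>j - i + 1\<close> of which meet \<open>e\<close>; the condition \<open>e \<notin> G\<close> is automatic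
  because an edge of \<open>G\<close> meets a single component and \<open>j - i + 1 \<ge> 2\<close>. Grouping these \<open>G\<close> by
  their partition into components, each group is parametrised by independent choices of connected
  spanning edge sets of the parts, and its sum factorises into the values of \<open>a1\<close>.\<close>

section \<open>Components, edges and walks\<close>

abbreviation components :: "'a set \<Rightarrow> 'a set set \<Rightarrow> 'a set set" where
  "components V F \<equiv> V // connected_rel V F"

lemma partition_on_components: "partition_on V (components V F)"
  by (rule partition_on_quotient[OF equiv_connected_rel])

lemma neighbours_mono: "W \<subseteq> V \<Longrightarrow> F \<subseteq> G \<Longrightarrow> neighbours W F \<subseteq> neighbours V G"
  by (auto simp: neighbours_def)

lemma rtrancl_neighbours_mono:
  "(u, v) \<in> (neighbours W F)\<^sup>* \<Longrightarrow> W \<subseteq> V \<Longrightarrow> F \<subseteq> G \<Longrightarrow> (u, v) \<in> (neighbours V G)\<^sup>*"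
  using rtrancl_mono[OF neighbours_mono] by blast

lemma components_connected:
  assumes "W \<in> components V F" "u \<in> W" "v \<in> W"
  shows "(u, v) \<in> (neighbours V F)\<^sup>*"
  using quotient_eq_iff[OF equiv_connected_rel assms(1,1,2,3)] by (auto simp: connected_rel_def)

text \<open>Distinct vertices of \<open>f\<close> are neighbours, so one vertex of \<open>f\<close>
  in the class \<open>W\<close> draws in all the others.\<close>

lemma edge_subset_component:
  assumes "f \<in> F" "f \<subseteq> V" "W \<in> components V F" "W \<inter> f \<noteq> {}"
  shows "f \<subseteq> W"
proof
  fix v assume v: "v \<in> f"
  from assms(4) obtain u where u: "u \<in> W" "u \<in> f"
    by blast
  have "(u, v) \<in> (neighbours V F)\<^sup>*"
    using assms(1,2) u(2) v by (cases "u = v") (auto simp: neighbours_def intro!: r_into_rtrancl)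
  then have "(u, v) \<in> connected_rel V F"
    using assms(2) u v by (auto simp: connected_rel_def)
  then show "v \<in> W"
    using in_quotient_imp_closed[OF equiv_connected_rel assms(3) u(1)] by blast
qed

lemma ex_component_superset:
  assumes "f \<in> F" "f \<subseteq> V" "f \<noteq> {}"
  shows "\<exists>W\<in>components V F. f \<subseteq> W"
proof -
  obtain u where "u \<in> f"
    using assms(3) by blast
  moreover have "\<Union>(components V F) = V"
    using partition_onD1[OF partition_on_components] by metis
  ultimately obtain W where "W \<in> components V F" "u \<in> W"
    using assms(2) by blast
  then show ?thesis
    using edge_subset_component[OF assms(1,2)] \<open>u \<in> f\<close> by blast
qed

text \<open>A walk cannot leave \<open>W\<close>: each edge it uses meets \<open>W\<close> in the
  current vertex, hence lies inside \<open>W\<close>. The same edges are therefore available in the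
  induced hypergraph.\<close>

lemma rtrancl_neighbours_restrict:
  assumes "(u, v) \<in> (neighbours V F)\<^sup>*" "u \<in> W" "\<And>f. f \<in> F \<Longrightarrow> W \<inter> f \<noteq> {} \<Longrightarrow> f \<subseteq> W"
  shows "v \<in> W \<and> (u, v) \<in> (neighbours W (induced_edges F W))\<^sup>*"
  using assms(1)
proof (induction rule: rtrancl_induct)
  case base
  then show ?case using assms(2) by simp
next
  case (step y z)
  then obtain f where "f \<in> F" "y \<in> f" "z \<in> f" "y \<noteq> z"
    by (auto simp: neighbours_def)
  moreover from this have "f \<subseteq> W"
    using assms(3) step.IH by blast
  ultimately have "z \<in> W" "(y, z) \<in> neighbours W (induced_edges F W)"
    by (auto simp: neighbours_def induced_edges_def)
  then show ?case
    using step.IH by (meson rtrancl.rtrancl_into_rtrancl)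
qed

section \<open>Recognising the partition into components\<close>

text \<open>Assumption \<open>edges\<close> keeps walks inside a part and \<open>conn\<close> lets
  them reach all of it, so connectedness is exactly the relation of lying in a common part, and its
  quotient is \<open>P\<close>.\<close>

lemma components_eqI:
  assumes P: "partition_on V P"
    and edges: "\<And>f. f \<in> F \<Longrightarrow> \<exists>W\<in>P. f \<subseteq> W"
    and conn: "\<And>W u v. W \<in> P \<Longrightarrow> u \<in> W \<Longrightarrow> v \<in> W \<Longrightarrow> (u, v) \<in> (neighbours V F)\<^sup>*"
  shows "components V F = P"
proof -
  have closed: "f \<subseteq> W" if f: "f \<in> F" "W \<in> P" "W \<inter> f \<noteq> {}" for f W
  proof -
    obtain X where X: "X \<in> P" "f \<subseteq> X"
      using edges[OF f(1)] by blast
    then have "W \<inter> X \<noteq> {}"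
      using f(3) by blast
    then have "X = W"
      using disjointD[OF partition_onD2[OF P] f(2) X(1)] by blast
    with X show ?thesis
      by simp
  qed
  have "connected_rel V F = {(u, v). \<exists>W\<in>P. u \<in> W \<and> v \<in> W}"
  proof (intro equalityI subrelI)
    fix u v assume "(u, v) \<in> connected_rel V F"
    then have uv: "u \<in> V" "(u, v) \<in> (neighbours V F)\<^sup>*"
      by (auto simp: connected_rel_def)
    obtain W where "W \<in> P" "u \<in> W"
      using uv(1) partition_onD1[OF P] by blast
    moreover from this have "v \<in> W"
      using rtrancl_neighbours_restrict[OF uv(2), of W] closed by simp
    ultimately show "(u, v) \<in> {(u, v). \<exists>W\<in>P. u \<in> W \<and> v \<in> W}"
      by blast
  next
    fix u v assume "(u, v) \<in> {(u, v). \<exists>W\<in>P. u \<in> W \<and> v \<in> W}"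
    then show "(u, v) \<in> connected_rel V F"
      using conn partition_onD1[OF P] by (auto simp: connected_rel_def)
  qed
  then show ?thesis
    using partition_on_eq_quotient[OF P] by simp
qed

text \<open>Translates the summation condition of \<open>a1\<close> into reachability. The empty
  vertex set has to be excluded, having no component at all.\<close>

lemma num_components_eq_1_iff:
  "num_components W F = 1 \<longleftrightarrow> W \<noteq> {} \<and> (\<forall>u\<in>W. \<forall>v\<in>W. (u, v) \<in> (neighbours W F)\<^sup>*)"
proof
  assume "num_components W F = 1"
  then obtain X where X: "components W F = {X}"
    by (auto simp: num_components_def card_1_singleton_iff)
  then have "X = W"
    using partition_onD1[OF partition_on_components, of W F] by simp
  with X show "W \<noteq> {} \<and> (\<forall>u\<in>W. \<forall>v\<in>W. (u, v) \<in> (neighbours W F)\<^sup>*)"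
    using components_connected[of W W F] by (auto simp: quotient_def)
next
  assume *: "W \<noteq> {} \<and> (\<forall>u\<in>W. \<forall>v\<in>W. (u, v) \<in> (neighbours W F)\<^sup>*)"
  then have "connected_rel W F = W \<times> W"
    by (auto simp: connected_rel_def)
  then have "components W F = {W}"
    using * by (auto simp: quotient_def)
  then show "num_components W F = 1"
    by (simp add: num_components_def)
qed

text \<open>Splits the global condition on \<open>F\<close> into separate conditions on the edges
  inside each part; this independence is what makes the sum over \<open>F\<close> factorise.\<close>

lemma components_eq_iff:
  assumes P: "partition_on V P" and F: "\<And>f. f \<in> F \<Longrightarrow> f \<subseteq> V \<and> f \<noteq> {}"
  shows "components V F = P \<longleftrightarrow>
    (\<forall>f\<in>F. \<exists>W\<in>P. f \<subseteq> W) \<and> (\<forall>W\<in>P. num_components W (induced_edges F W) = 1)"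
proof
  assume eq: "components V F = P"
  have "num_components W (induced_edges F W) = 1" if W: "W \<in> P" for W
    unfolding num_components_eq_1_iff
  proof (intro conjI ballI)
    show "W \<noteq> {}"
      using W partition_onD3[OF P] by blast
    show "(u, v) \<in> (neighbours W (induced_edges F W))\<^sup>*" if "u \<in> W" "v \<in> W" for u v
      using rtrancl_neighbours_restrict[OF components_connected[of W V F u v]]
        edge_subset_component[of _ F V W] W F that unfolding eq by blast
  qed
  then show "(\<forall>f\<in>F. \<exists>W\<in>P. f \<subseteq> W) \<and> (\<forall>W\<in>P. num_components W (induced_edges F W) = 1)"
    using ex_component_superset[of _ F V] F unfolding eq by blast
next
  assume *: "(\<forall>f\<in>F. \<exists>W\<in>P. f \<subseteq> W) \<and> (\<forall>W\<in>P. num_components W (induced_edges F W) = 1)"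
  show "components V F = P"
  proof (rule components_eqI[OF P])
    fix W u v assume W: "W \<in> P" "u \<in> W" "v \<in> W"
    then have "(u, v) \<in> (neighbours W (induced_edges F W))\<^sup>*"
      using * num_components_eq_1_iff[of W "induced_edges F W"] by blast
    then show "(u, v) \<in> (neighbours V F)\<^sup>*"
      by (rule rtrancl_neighbours_mono)
        (use W partition_onD1[OF P] in \<open>auto simp: induced_edges_def\<close>)
  qed (use * in blast)
qed

section \<open>The effect of adding an edge\<close>

text \<open>All old walks survive, and \<open>e\<close> links any two of the classes in
  \<open>M\<close>. No further merging occurs, since \<open>e\<close> lies inside
  \<open>\<Union>M\<close> and every other edge inside one old class.\<close>

lemma components_insert:
  assumes e: "e \<subseteq> V" "e \<noteq> {}" and F: "\<And>f. f \<in> F \<Longrightarrow> f \<subseteq> V \<and> f \<noteq> {}"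
  defines "M \<equiv> {W \<in> components V F. W \<inter> e \<noteq> {}}"
  shows "components V (insert e F) = insert (\<Union>M) (components V F - M)"
proof (rule components_eqI)
  let ?P = "components V F"
  have P: "partition_on V ?P"
    by (rule partition_on_components)
  have V: "\<Union>?P = V"
    using partition_onD1[OF P] by simp
  have M: "M \<subseteq> ?P"
    by (auto simp: M_def)
  have eM: "e \<subseteq> \<Union>M"
    using e(1) V unfolding M_def by blast
  show "partition_on V (insert (\<Union>M) (?P - M))"
  proof (rule partition_onI)
    have "\<Union>(insert (\<Union>M) (?P - M)) = \<Union>?P"
      using M by blast
    then show "\<Union>(insert (\<Union>M) (?P - M)) = V"
      unfolding V .
    have "\<Union>M \<noteq> {}"
      using eM e(2) by (metis subset_empty)
    then show "{} \<notin> insert (\<Union>M) (?P - M)"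
      using partition_onD3[OF P] by (metis DiffD1 insertE)
    have disj: "p \<inter> q = {}" if "p \<in> ?P" "q \<in> ?P" "p \<noteq> q" for p q
      by (rule disjointD[OF partition_onD2[OF P] that])
    have disj_M: "p \<inter> \<Union>M = {}" if "p \<in> ?P - M" for p
    proof -
      have "p \<inter> X = {}" if "X \<in> M" for X
        using disj[of p X] \<open>p \<in> ?P - M\<close> that M by (metis Diff_iff subsetD)
      then show ?thesis
        by blast
    qed
    show "disjnt p q"
      if "p \<in> insert (\<Union>M) (?P - M)" "q \<in> insert (\<Union>M) (?P - M)" "p \<noteq> q" for p q
      using that disj[of p q] disj_M[of p] disj_M[of q] unfolding disjnt_def
      by (metis DiffD1 Int_commute insertE)
  qed
  show "\<exists>W\<in>insert (\<Union>M) (?P - M). f \<subseteq> W" if f: "f \<in> insert e F" for f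
  proof (cases "f = e")
    case False
    then obtain W where "W \<in> ?P" "f \<subseteq> W"
      using f F ex_component_superset[of f F V] by blast
    then show ?thesis
      by (cases "W \<in> M") auto
  qed (use eM in blast)
  have mono: "(u, v) \<in> (neighbours V (insert e F))\<^sup>*" if "W \<in> ?P" "u \<in> W" "v \<in> W" for u v W
    using rtrancl_neighbours_mono[OF components_connected[OF that]] by blast
  have edge: "(a, b) \<in> (neighbours V (insert e F))\<^sup>*" if "a \<in> e" "b \<in> e" for a b
    using that e(1) by (cases "a = b") (auto simp: neighbours_def intro!: r_into_rtrancl)
  show "(u, v) \<in> (neighbours V (insert e F))\<^sup>*"
    if W: "W \<in> insert (\<Union>M) (?P - M)" "u \<in> W" "v \<in> W" for W u v
  proof (cases "W = \<Union>M")
    \<comment> \<open>The walk goes from \<open>u\<close> to \<open>a\<close> inside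
      \<open>X\<close>, along \<open>e\<close> from \<open>a\<close> to \<open>b\<close>, then from
      \<open>b\<close> to \<open>v\<close> inside \<open>Y\<close>.\<close>
    case True
    then obtain X Y where X: "X \<in> ?P" "X \<inter> e \<noteq> {}" "u \<in> X" and Y: "Y \<in> ?P" "Y \<inter> e \<noteq> {}" "v \<in> Y"
      using W by (auto simp: M_def)
    then obtain a b where "a \<in> X" "a \<in> e" "b \<in> Y" "b \<in> e"
      by blast
    then show ?thesis
      using mono[of X u a] edge[of a b] mono[of Y b v] X Y by (meson rtrancl_trans)
  qed (use W mono in blast)
qed

lemma finite_components: "finite V \<Longrightarrow> finite (components V F)"
  using finite_elements[OF _ partition_on_components] .

text \<open>The classes meeting \<open>e\<close> are replaced by a single one. The additive form
  avoids truncated subtraction.\<close>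

lemma num_components_insert:
  assumes "finite V" "e \<subseteq> V" "e \<noteq> {}" and "\<And>f. f \<in> F \<Longrightarrow> f \<subseteq> V \<and> f \<noteq> {}"
  shows "num_components V (insert e F) + card {W \<in> components V F. W \<inter> e \<noteq> {}} =
    num_components V F + 1"
proof -
  let ?P = "components V F"
  let ?M = "{W \<in> ?P. W \<inter> e \<noteq> {}}"
  have fin: "finite ?P"
    by (rule finite_components[OF assms(1)])
  have "e \<subseteq> \<Union>?M"
    using assms(2) partition_onD1[OF partition_on_components, of V F] by blast
  \<comment> \<open>The merged class contains the non-empty \<open>e\<close>, whereas no class in
    \<open>?P - ?M\<close> meets \<open>e\<close>; so it counts as one new element.\<close>
  then have "\<Union>?M \<notin> ?P - ?M"
    using assms(3) by blast
  then have "card (insert (\<Union>?M) (?P - ?M)) = Suc (card (?P - ?M))"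
    using fin by (intro card_insert_disjoint finite_Diff)
  moreover have "components V (insert e F) = insert (\<Union>?M) (?P - ?M)"
    using assms(2-4) by (rule components_insert)
  ultimately have "num_components V (insert e F) = Suc (card (?P - ?M))"
    by (simp only: num_components_def)
  moreover have "card (?P - ?M) + card ?M = card ?P"
    using fin by (subst card_Diff_subset) (auto intro!: card_mono le_add_diff_inverse2)
  ultimately show ?thesis
    by (simp add: num_components_def)
qed

section \<open>Factorisation over the parts\<close>

text \<open>Expanding the product of sums gives a sum over functions \<open>g\<close> choosing a
  connected spanning edge set for each part; such \<open>g\<close> correspond to the edge sets
  \<open>F\<close> by taking the union of the choices.\<close>

lemma sum_components_eq_prod_a1:
  assumes "finite V" "finite E" and E: "\<And>f. f \<in> E \<Longrightarrow> f \<subseteq> V \<and> f \<noteq> {}" and P: "partition_on V P"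
  shows "(\<Sum>F | F \<subseteq> E \<and> components V F = P. (-1) ^ card F) =
    (\<Prod>W\<in>P. a1 W (induced_edges E W))"
proof -
  define C where "C W = {F. F \<subseteq> induced_edges E W \<and> num_components W F = 1}" for W
  have finP: "finite P"
    by (rule finite_elements[OF assms(1) P])
  have finC: "finite (C W)" for W
    using assms(2) by (auto simp: C_def induced_edges_def)
  have disj: "W = W'" if "W \<in> P" "W' \<in> P" "f \<subseteq> W" "f \<subseteq> W'" "f \<noteq> {}" for W W' f
    using disjointD[OF partition_onD2[OF P] that(1,2)] that(3-5) by blast
  have C_edge: "f \<in> E \<and> f \<subseteq> W \<and> f \<noteq> {}" if "g \<in> PiE P C" "W \<in> P" "f \<in> g W" for g W f
    using that E by (fastforce simp: C_def induced_edges_def dest: PiE_mem)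
  \<comment> \<open>Restricting the union to \<open>W\<close> recovers the choice
    \<open>g W\<close>: an edge chosen for another part is non-empty and so cannot also lie in
    \<open>W\<close>.\<close>
  have induced: "induced_edges (\<Union>(g ` P)) W = g W" if g: "g \<in> PiE P C" "W \<in> P" for g W
  proof (intro set_eqI iffI)
    fix f assume "f \<in> induced_edges (\<Union>(g ` P)) W"
    then obtain W' where W': "W' \<in> P" "f \<in> g W'" and f: "f \<subseteq> W"
      by (auto simp: induced_edges_def)
    then have "W' = W"
      using disj[of W' W f] C_edge[OF g(1) W'] g(2) by simp
    with W' show "f \<in> g W"
      by simp
  next
    fix f assume "f \<in> g W"
    then show "f \<in> induced_edges (\<Union>(g ` P)) W"
      using C_edge[OF g] g(2) by (auto simp: induced_edges_def)
  qed
  have "(\<Prod>W\<in>P. a1 W (induced_edges E W)) = (\<Prod>W\<in>P. \<Sum>F\<in>C W. (-1) ^ card F)"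
    by (simp add: a1_def C_def)
  also have "\<dots> = (\<Sum>g\<in>PiE P C. \<Prod>W\<in>P. (-1) ^ card (g W))"
    by (rule prod_sum_PiE[OF finP finC])
  also have "\<dots> = (\<Sum>F | F \<subseteq> E \<and> components V F = P. (-1) ^ card F)"
  proof (rule sum.reindex_bij_witness[where i = "\<lambda>F. \<lambda>W\<in>P. induced_edges F W"
        and j = "\<lambda>g. \<Union>(g ` P)"])
    fix g assume g: "g \<in> PiE P C"
    \<comment> \<open>Outside \<open>P\<close> both functions take the value
      \<open>undefined\<close>.\<close>
    show "(\<lambda>W\<in>P. induced_edges (\<Union>(g ` P)) W) = g"
      using induced[OF g] PiE_arb[OF g] by (intro ext) (simp add: restrict_def)
    have sub: "\<Union>(g ` P) \<subseteq> E"
      using C_edge[OF g] by blast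
    moreover have "components V (\<Union>(g ` P)) = P"
    proof (subst components_eq_iff[OF P])
      show "f \<subseteq> V \<and> f \<noteq> {}" if "f \<in> \<Union>(g ` P)" for f
        using that sub E by blast
      have "num_components W (g W) = 1" if "W \<in> P" for W
        using PiE_mem[OF g that] by (simp add: C_def)
      moreover have "\<forall>f\<in>\<Union>(g ` P). \<exists>W\<in>P. f \<subseteq> W"
        using C_edge[OF g] by blast
      ultimately show "(\<forall>f\<in>\<Union>(g ` P). \<exists>W\<in>P. f \<subseteq> W) \<and>
          (\<forall>W\<in>P. num_components W (induced_edges (\<Union>(g ` P)) W) = 1)"
        using induced[OF g] by simp
    qed
    ultimately show "\<Union>(g ` P) \<in> {F. F \<subseteq> E \<and> components V F = P}"
      by blast
    \<comment> \<open>The chosen edge sets are pairwise disjoint, so their sizes add and their signs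
      multiply.\<close>
    have "card (\<Union>(g ` P)) = (\<Sum>W\<in>P. card (g W))"
    proof (rule card_UN_disjoint[OF finP])
      show "\<forall>W\<in>P. finite (g W)"
        using C_edge[OF g] assms(2) by (meson finite_subset subsetI)
      show "\<forall>W\<in>P. \<forall>W'\<in>P. W \<noteq> W' \<longrightarrow> g W \<inter> g W' = {}"
        using C_edge[OF g] disj by blast
    qed
    then show "(-1) ^ card (\<Union>(g ` P)) = (\<Prod>W\<in>P. (-1 :: int) ^ card (g W))"
      by (simp add: power_sum)
  next
    fix F assume "F \<in> {F. F \<subseteq> E \<and> components V F = P}"
    then have F: "F \<subseteq> E" "components V F = P"
      by auto
    have *: "(\<forall>f\<in>F. \<exists>W\<in>P. f \<subseteq> W) \<and> (\<forall>W\<in>P. num_components W (induced_edges F W) = 1)"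
      using components_eq_iff[OF P, of F] F E by blast
    show "\<Union>((\<lambda>W\<in>P. induced_edges F W) ` P) = F"
      using * by (auto simp: induced_edges_def)
    show "(\<lambda>W\<in>P. induced_edges F W) \<in> PiE P C"
      using * F(1) by (auto simp: C_def induced_edges_def)
  qed
  finally show ?thesis
    by simp
qed

section \<open>Reindexing and grouping the signed sum\<close>

theorem proposition3p3:
  fixes V :: "'a set" and E :: "'a set set" and e :: "'a set" and i j :: nat
  assumes "hypergraph V E"
    and "e \<in> E"
    and "1 \<le> i" and "i < j" and "j \<le> card V"
  shows "b_coeff V E e i j =
    - (\<Sum>P\<in>decompositions V e j (j - i + 1). \<Prod>W\<in>P. a1 W (induced_edges E W))"
proof -
  let ?D = "decompositions V e j (j - i + 1)"
  define S where "S = {G. G \<subseteq> E \<and> components V G \<in> ?D}"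
  have finV: "finite V" and E: "\<And>f. f \<in> E \<Longrightarrow> f \<subseteq> V \<and> f \<noteq> {}"
    using assms(1) by (auto simp: hypergraph_def)
  have finE: "finite E"
    using E finV by (intro finite_subset[of E "Pow V"]) auto
  have finD: "finite ?D"
    using finitely_many_partition_on[OF finV]
    by (rule rev_finite_subset) (auto simp: decompositions_def)
  \<comment> \<open>If \<open>G\<close> has \<open>j\<close> components, \<open>m\<close> of them
    meeting \<open>e\<close>, then adding \<open>e\<close> leaves \<open>j + 1 - m\<close>, which is
    \<open>i\<close> exactly when \<open>m = j - i + 1\<close>. Since \<open>i < j\<close>, the
    natural subtraction is exact.\<close>
  have S_iff: "G \<in> S \<longleftrightarrow> num_components V (insert e G) = i \<and> num_components V G = j"
    if G: "G \<subseteq> E" for G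
  proof -
    have "num_components V (insert e G) + card {W \<in> components V G. W \<inter> e \<noteq> {}} =
        num_components V G + 1"
      using num_components_insert[OF finV, of e G] E assms(2) G by blast
    then show ?thesis
      using G assms(4) partition_on_components[of V G]
      by (auto simp: S_def decompositions_def num_components_def)
  qed
  \<comment> \<open>If \<open>e\<close> were in \<open>G\<close>, then \<open>insert e G = G\<close>
    would force \<open>i = j\<close>.\<close>
  have notin: "e \<notin> G" if "G \<in> S" for G
    using S_iff[of G] that assms(4) by (auto simp: insert_absorb S_def)
  \<comment> \<open>Removing \<open>e\<close> maps the family bijectively onto \<open>S\<close> and
    flips each sign.\<close>
  have "b_coeff V E e i j = (\<Sum>G\<in>S. - ((-1) ^ card G))"
    unfolding b_coeff_def
  proof (rule sum.reindex_bij_witness[where i = "insert e" and j = "\<lambda>F. F - {e}"])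
    fix F assume "F \<in> b_family V E e i j"
    then have F: "F \<subseteq> E" "e \<in> F" "num_components V F = i" "num_components V (F - {e}) = j"
      by (auto simp: b_family_def)
    then show "insert e (F - {e}) = F" "F - {e} \<in> S"
      using S_iff[of "F - {e}"] by (auto simp: insert_absorb)
    have "card F = Suc (card (F - {e}))"
      using F(1,2) finE by (metis card.remove finite_subset)
    then show "- ((-1) ^ card (F - {e})) = (-1 :: int) ^ card F"
      by simp
  next
    fix G assume G: "G \<in> S"
    then have "G \<subseteq> E"
      by (simp add: S_def)
    then show "insert e G - {e} = G" "insert e G \<in> b_family V E e i j"
      using G notin[OF G] S_iff[of G] assms(2) by (auto simp: b_family_def)
  qed
  also have "\<dots> = - (\<Sum>G\<in>S. (-1) ^ card G)"
    by (rule sum_negf)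
  \<comment> \<open>Each \<open>G\<close> in \<open>S\<close> belongs to exactly one group, indexed
    by its own partition into components.\<close>
  also have "(\<Sum>G\<in>S. (-1) ^ card G) =
      (\<Sum>P\<in>?D. \<Sum>G | G \<in> S \<and> components V G = P. (-1 :: int) ^ card G)"
    by (rule sum.group[symmetric]) (use finE finD in \<open>auto simp: S_def\<close>)
  also have "\<dots> = (\<Sum>P\<in>?D. \<Prod>W\<in>P. a1 W (induced_edges E W))"
  proof (rule sum.cong[OF refl])
    fix P assume P: "P \<in> ?D"
    then have "{G. G \<in> S \<and> components V G = P} = {G. G \<subseteq> E \<and> components V G = P}"
      by (auto simp: S_def)
    then show "(\<Sum>G | G \<in> S \<and> components V G = P. (-1) ^ card G) =
        (\<Prod>W\<in>P. a1 W (induced_edges E W))"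
      using sum_components_eq_prod_a1[OF finV finE E, of P] P by (simp add: decompositions_def)
  qed
  finally show ?thesis .
qed

end
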